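(* Let $n\ge1$, let $a=v_0<v_1<\dots<v_n=b$, let $\zeta_i\in(v_i,v_{i+1})$ for $0\le i\le n-1$, put $\zeta_{-1}=v_0$, $\zeta_n=v_n$, and let $\varphi(i)\ge 2$ be integers for $0\le i\le n$. For $f:[a,b]\to\mathbb{R}$, $0\le i\le n$ and $|\alpha|=\varphi(i)-1$, set $$\nu_{i,\alpha}(f)=\mathbf{M}[f]\bigl(v_i,\zeta_{i-1}[\alpha_1],\zeta_i[\alpha_2]\bigr),$$ where, for $m\ge1$ and $u_1,\dots,u_m\in[a,b]$, $$\mathbf{M}[f](u_1,\dots,u_m)=\frac{1}{m!}\sum_{\substack{\emptyset\ne S\subset\{1,\dots,m\}\\ k=|S|}}(-1)^{m-k}\,k^{m}\,f\Bigl(\frac1k\sum_{r\in S}u_r\Bigr)$$ (used here with $m=\varphi(i)$). Then the operator $$\mathcal{Q}_{\varphi,\overline{\tau}_n}f=\sum_{i=0}^{n}\ \sum_{|\alpha|=\varphi(i)-1}\nu_{i,\alpha}(f)\,\mathcal{N}_{i,\alpha}$$ satisfies $\mathcal{Q}_{\varphi,\overline{\tau}_n}\tilde p=\tilde p$ on $[a,b]$ for all $\tilde p\in\mathbb{P}_{\min_{0\le i\le n}\varphi(i)}$.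
   Context: The notation $v[\ell]$ means that the argument $v$ is repeated $\ell$ times. $\mathbb{P}_d$ is the space of real polynomials of degree $\le d$. The space $\mathcal{S}^1(\varphi,\overline{\tau}_n)$ consists of all functions $s:[a,b]\to\mathbb{R}$ such that: (i) for each $0\le i\le n$, the restrictions of $s$ to $[\zeta_{i-1},v_i]$ and to $[v_i,\zeta_i]$ (when non-degenerate) are in $\mathbb{P}_{\varphi(i)}$; (ii) $s$ is $\mathcal{C}^{\varphi(i)-1}$ at $v_i$ for $0<i<n$; (iii) $s$ is $\mathcal{C}^1$ at $\zeta_i$ for $0\le i\le n-1$ ("$\mathcal{C}^r$ at a point" means that the derivatives of orders $0,\dots,r$ of the two adjacent polynomial pieces agree there). A function $s\in\mathcal{S}^1(\varphi,\overline{\tau}_n)$ exists and is unique with arbitrarily prescribed values $s^{(j)}(v_i)$, $0\le i\le n$, $0\le j\le\varphi(i)-1$ (one-sided derivatives at $a$, $b$). For a multi-index $\alpha=(\alpha_1,\alpha_2)\in\mathbb{Z}_{\ge0}^2$ with $|\alpha|=\alpha_1+\alpha_2=d$ and an interval $[A,B]$, the Bernstein polynomial is $\mathfrak{B}^d_{\alpha,[A,B]}(v)=\frac{d!}{\alpha_1!\alpha_2!}\frac{(B-v)^{\alpha_1}(v-A)^{\alpha_2}}{(B-A)^d}$. For $0\le i\le n$ let $\theta_i=\frac{\varphi(i)-1}{\varphi(i)}$, $S_{i,1}=\theta_i\zeta_{i-1}+(1-\theta_i)v_i$, $S_{i,2}=\theta_i\zeta_i+(1-\theta_i)v_i$, and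 $S_i=[S_{i,1},S_{i,2}]$ (so $S_{0,1}=v_0$ and $S_{n,2}=v_n$). For $|\alpha|=\varphi(i)-1$ and $0\le j\le\varphi(i)-1$ set $$\gamma_{i,\alpha}^j=\frac{\binom{\varphi(i)}{j}}{\binom{\varphi(i)-1}{j}}\,\theta_i^j\,\bigl(\mathfrak{B}^{\varphi(i)-1}_{\alpha,S_i}\bigr)^{(j)}(v_i).$$ The B-spline-like function $\mathcal{N}_{i,\alpha}$ is the unique element of $\mathcal{S}^1(\varphi,\overline{\tau}_n)$ with $\mathcal{N}_{i,\alpha}^{(j)}(v_i)=\gamma_{i,\alpha}^j$ for $0\le j\le\varphi(i)-1$ and $\mathcal{N}_{i,\alpha}^{(j)}(v_k)=0$ for $k\ne i$, $0\le j\le\varphi(k)-1$. *)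

theory Defs
  imports "HOL-Analysis.Analysis" "HOL-Computational_Algebra.Polynomial"
begin

text \<open>
  Throughout, \<open>v :: nat \<Rightarrow> real\<close> holds the vertices \<open>v 0 < \<dots> < v n\<close>, and the split points are indexed
  by integers so that \<open>\<zeta> (- 1) = v 0\<close> and \<open>\<zeta> (int n) = v n\<close> make sense.  The domain is
  \<open>[a,b] = {v 0..v n}\<close>.
\<close>

text \<open>
  Iterated derivative relative to a set \<open>X\<close>; for \<open>X = {a..b}\<close> it is one-sided at \<open>a\<close> and \<open>b\<close>.
\<close>

definition nth_deriv_within :: "real set \<Rightarrow> nat \<Rightarrow> (real \<Rightarrow> real) \<Rightarrow> real \<Rightarrow> real" where
  "nth_deriv_within X j s = ((\<lambda>g x. vector_derivative g (at x within X)) ^^ j) s"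

text \<open>The derivatives of orders \<open>0, \<dots>, r\<close> of two adjacent polynomial pieces agree at \<open>x\<close>.\<close>

definition smooth_join :: "nat \<Rightarrow> real \<Rightarrow> real poly \<Rightarrow> real poly \<Rightarrow> bool" where
  "smooth_join r x p q \<longleftrightarrow> (\<forall>j\<le>r. poly ((pderiv ^^ j) p) x = poly ((pderiv ^^ j) q) x)"

text \<open>
  The spline space.  Here \<open>L i\<close> and \<open>R i\<close> are the pieces to the left and to the right of \<open>v i\<close>.
  Functions on \<open>[a,b]\<close> are total functions that are \<open>extensional\<close>, i.e. \<open>undefined\<close> off \<open>[a,b]\<close>, so
  that equality in the space is equality on \<open>[a,b]\<close>.
\<close>

definition spline_space ::
    "nat \<Rightarrow> (nat \<Rightarrow> real) \<Rightarrow> (int \<Rightarrow> real) \<Rightarrow> (nat \<Rightarrow> nat) \<Rightarrow> (real \<Rightarrow> real) set" where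
  "spline_space n v \<zeta> \<phi> = {s \<in> extensional {v 0..v n}. \<exists>L R :: nat \<Rightarrow> real poly.
     (\<forall>i\<le>n. degree (L i) \<le> \<phi> i \<and> degree (R i) \<le> \<phi> i \<and>
        (\<zeta> (int i - 1) < v i \<longrightarrow> (\<forall>x\<in>{\<zeta> (int i - 1)..v i}. s x = poly (L i) x)) \<and>
        (v i < \<zeta> (int i) \<longrightarrow> (\<forall>x\<in>{v i..\<zeta> (int i)}. s x = poly (R i) x))) \<and>
     (\<forall>i. 0 < i \<and> i < n \<longrightarrow> smooth_join (\<phi> i - 1) (v i) (L i) (R i)) \<and>
     (\<forall>i<n. smooth_join 1 (\<zeta> (int i)) (R i) (L (Suc i)))}"

definition bernstein_on :: "real \<Rightarrow> real \<Rightarrow> nat \<times> nat \<Rightarrow> real \<Rightarrow> real" where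
  "bernstein_on A B = (\<lambda>(\<alpha>1, \<alpha>2) x.
     fact (\<alpha>1 + \<alpha>2) / (fact \<alpha>1 * fact \<alpha>2) *
       ((B - x) ^ \<alpha>1 * (x - A) ^ \<alpha>2 / (B - A) ^ (\<alpha>1 + \<alpha>2)))"

definition theta :: "(nat \<Rightarrow> nat) \<Rightarrow> nat \<Rightarrow> real" where
  "theta \<phi> i = (real (\<phi> i) - 1) / real (\<phi> i)"

definition S1 :: "(nat \<Rightarrow> real) \<Rightarrow> (int \<Rightarrow> real) \<Rightarrow> (nat \<Rightarrow> nat) \<Rightarrow> nat \<Rightarrow> real" where
  "S1 v \<zeta> \<phi> i = theta \<phi> i * \<zeta> (int i - 1) + (1 - theta \<phi> i) * v i"

definition S2 :: "(nat \<Rightarrow> real) \<Rightarrow> (int \<Rightarrow> real) \<Rightarrow> (nat \<Rightarrow> nat) \<Rightarrow> nat \<Rightarrow> real" where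
  "S2 v \<zeta> \<phi> i = theta \<phi> i * \<zeta> (int i) + (1 - theta \<phi> i) * v i"

definition multi_indices :: "nat \<Rightarrow> (nat \<times> nat) set" where
  "multi_indices d = {(\<alpha>1, \<alpha>2). \<alpha>1 + \<alpha>2 = d}"

definition gam ::
    "(nat \<Rightarrow> real) \<Rightarrow> (int \<Rightarrow> real) \<Rightarrow> (nat \<Rightarrow> nat) \<Rightarrow> nat \<Rightarrow> nat \<times> nat \<Rightarrow> nat \<Rightarrow> real" where
  "gam v \<zeta> \<phi> i \<alpha> j =
     real (\<phi> i choose j) / real ((\<phi> i - 1) choose j) * theta \<phi> i ^ j *
       (deriv ^^ j) (bernstein_on (S1 v \<zeta> \<phi> i) (S2 v \<zeta> \<phi> i) \<alpha>) (v i)"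

definition bspline ::
    "nat \<Rightarrow> (nat \<Rightarrow> real) \<Rightarrow> (int \<Rightarrow> real) \<Rightarrow> (nat \<Rightarrow> nat) \<Rightarrow> nat \<Rightarrow> nat \<times> nat \<Rightarrow> real \<Rightarrow> real" where
  "bspline n v \<zeta> \<phi> i \<alpha> = (THE s. s \<in> spline_space n v \<zeta> \<phi> \<and>
     (\<forall>j\<le>\<phi> i - 1. nth_deriv_within {v 0..v n} j s (v i) = gam v \<zeta> \<phi> i \<alpha> j) \<and>
     (\<forall>k\<le>n. k \<noteq> i \<longrightarrow> (\<forall>j\<le>\<phi> k - 1. nth_deriv_within {v 0..v n} j s (v k) = 0)))"

text \<open>The arguments \<open>u\<^sub>1, \<dots>, u\<^sub>m\<close> are given as a list, hence indexed from \<open>0\<close>.\<close>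

definition polar :: "(real \<Rightarrow> real) \<Rightarrow> real list \<Rightarrow> real" where
  "polar f us = (let m = length us in
     1 / fact m * (\<Sum>S | S \<noteq> {} \<and> S \<subseteq> {..<m}.
       (- 1) ^ (m - card S) * real (card S) ^ m * f (1 / real (card S) * (\<Sum>r\<in>S. us ! r))))"

definition nu ::
    "(nat \<Rightarrow> real) \<Rightarrow> (int \<Rightarrow> real) \<Rightarrow> nat \<Rightarrow> nat \<times> nat \<Rightarrow> (real \<Rightarrow> real) \<Rightarrow> real" where
  "nu v \<zeta> i = (\<lambda>(\<alpha>1, \<alpha>2) f.
     polar f (v i # replicate \<alpha>1 (\<zeta> (int i - 1)) @ replicate \<alpha>2 (\<zeta> (int i))))"

definition quasi_interpolant ::
    "nat \<Rightarrow> (nat \<Rightarrow> real) \<Rightarrow> (int \<Rightarrow> real) \<Rightarrow> (nat \<Rightarrow> nat) \<Rightarrow> (real \<Rightarrow> real) \<Rightarrow> real \<Rightarrow> real" where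
  "quasi_interpolant n v \<zeta> \<phi> f x =
     (\<Sum>i=0..n. \<Sum>\<alpha>\<in>multi_indices (\<phi> i - 1). nu v \<zeta> i \<alpha> f * bspline n v \<zeta> \<phi> i \<alpha> x)"

end

theory Submission
  imports Defs
begin

text \<open>
  By uniqueness of Hermite interpolation on each pair of adjacent pieces, it suffices to compare the
  derivatives of \<open>p\<close> and of its quasi-interpolant at the vertices.  At \<open>v i\<close> only the functions
  \<open>N\<^sub>i\<^sub>,\<^sub>\<alpha>\<close> contribute.  The required local identity is linear in \<open>p\<close>, so it need only be checked on
  \<open>p = (x + t)^m\<close> with \<open>m = \<phi> i\<close>.  There polarization gives
  \<open>M[p](u\<^sub>1, \<dots>, u\<^sub>m) = \<Prod>(t + u\<^sub>r)\<close>, and the binomial theorem turns the Bernstein sum into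
  \<open>(t + v i) * (t + x)^(m - 1)\<close>.
\<close>

subsection \<open>Polarization\<close>

text \<open>Expand (x + y)^i binomially: the forward difference cancels the top coefficient of
  \<open>P\<close>, and in degree \<open>n\<close> the coefficients of \<open>P\<close> itself
  cancel too, leaving only the contribution of the term of degree \<open>Suc n\<close>.\<close>

lemma degree_coeff_difference_poly:
  fixes P :: "real poly"
  assumes "degree P \<le> Suc n"
  shows "degree (pcompose P [:y, 1:] - P) \<le> n \<and>
    coeff (pcompose P [:y, 1:] - P) n = real (Suc n) * y * coeff P (Suc n)"
proof -
  let ?Q = "pcompose P [:y, 1:] - P"
  have lin: "coeff ([:y, 1:] ^ i) k = real (i choose k) * y ^ (i - k)" for i k
  proof (cases "k \<le> i")
    case False
    then have "degree ([:y, 1:] ^ i) < k"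
      using degree_power_le[of "[:y, 1:]" i] by simp
    with False show ?thesis by (simp add: coeff_eq_0)
  qed (simp add: coeff_linear_poly_power)
  have "pcompose P [:y, 1:] = (\<Sum>i\<le>Suc n. smult (coeff P i) ([:y, 1:] ^ i))"
    by (subst poly_as_sum_of_monoms'[OF assms, symmetric])
       (simp add: poly_eq_poly_eq_iff[symmetric] fun_eq_iff poly_pcompose poly_sum poly_monom add.commute
          del: sum.atMost_Suc power_Suc)
  then have coeff_Q: "coeff ?Q k = (\<Sum>i\<le>Suc n. coeff P i * (real (i choose k) * y ^ (i - k))) - coeff P k" for k
    by (simp add: coeff_sum lin del: sum.atMost_Suc power_Suc)
  have low: "(\<Sum>i<k. coeff P i * (real (i choose k) * y ^ (i - k))) = 0" for k
    by (intro sum.neutral) (auto simp: binomial_eq_0)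
  have "coeff ?Q k = 0" if "k > n" for k
  proof (cases "k = Suc n")
    case True
    then show ?thesis
      unfolding coeff_Q using low[of "Suc n"] by (simp add: lessThan_Suc_atMost[symmetric])
  next
    case False
    then show ?thesis
      unfolding coeff_Q using that assms by (simp add: coeff_eq_0 binomial_eq_0)
  qed
  moreover have "coeff ?Q n = real (Suc n) * y * coeff P (Suc n)"
    unfolding coeff_Q using low[of n] by (simp add: lessThan_Suc_atMost[symmetric])
  ultimately show ?thesis
    by (simp add: degree_le)
qed

text \<open>This is an iterated finite difference. Pairing each subset S of \<open>A\<close> with
  \<open>insert a S\<close>, which carries the opposite sign, replaces \<open>P\<close> by its
  difference with step \<open>y a\<close>. Each element thus lowers the degree by one and
  contributes one factor.\<close>

lemma sum_alternating_subsets_poly: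
  fixes P :: "real poly" and y :: "'a \<Rightarrow> real"
  assumes "finite A" "degree P \<le> card A"
  shows "(\<Sum>S\<in>Pow A. (- 1) ^ (card A - card S) * poly P (sum y S))
    = fact (card A) * coeff P (card A) * prod y A"
  using assms
proof (induction A arbitrary: P rule: finite_induct)
  case empty
  then have "poly P 0 = coeff P 0"
    by (simp add: poly_0_coeff_0)
  then show ?case by simp
next
  case (insert a A)
  let ?s = "\<lambda>S. (- 1 :: real) ^ (card A - card S)"
  let ?Q = "pcompose P [:y a, 1:] - P"
  have d: "degree ?Q \<le> card A" "coeff ?Q (card A) = real (Suc (card A)) * y a * coeff P (Suc (card A))"
    using degree_coeff_difference_poly[of P "card A" "y a"] insert by auto
  have inj: "inj_on (insert a) (Pow A)"
    using insert.hyps by (auto simp: inj_on_def)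
  have "(\<Sum>S\<in>Pow (insert a A). (- 1) ^ (card (insert a A) - card S) * poly P (sum y S))
      = (\<Sum>S\<in>Pow A. (- 1) ^ (Suc (card A) - card S) * poly P (sum y S))
        + (\<Sum>S\<in>insert a ` Pow A. (- 1) ^ (Suc (card A) - card S) * poly P (sum y S))"
    unfolding Pow_insert using insert.hyps by (subst sum.union_disjoint) auto
  also have "(\<Sum>S\<in>insert a ` Pow A. (- 1) ^ (Suc (card A) - card S) * poly P (sum y S))
      = (\<Sum>S\<in>Pow A. ?s S * poly P (y a + sum y S))"
    unfolding sum.reindex[OF inj] o_def
  proof (intro sum.cong refl)
    fix S assume "S \<in> Pow A"
    then have "finite S" "a \<notin> S" using insert.hyps finite_subset by auto
    then show "(- 1) ^ (Suc (card A) - card (insert a S)) * poly P (sum y (insert a S)) =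
      ?s S * poly P (y a + sum y S)" by simp
  qed
  also have "(\<Sum>S\<in>Pow A. (- 1) ^ (Suc (card A) - card S) * poly P (sum y S))
      = - (\<Sum>S\<in>Pow A. ?s S * poly P (sum y S))"
    unfolding sum_negf[symmetric]
  proof (intro sum.cong refl)
    fix S assume "S \<in> Pow A"
    then have "card S \<le> card A" using insert.hyps by (simp add: card_mono)
    then show "(- 1) ^ (Suc (card A) - card S) * poly P (sum y S) = - (?s S * poly P (sum y S))"
      by (simp add: Suc_diff_le)
  qed
  also have "- (\<Sum>S\<in>Pow A. ?s S * poly P (sum y S)) + (\<Sum>S\<in>Pow A. ?s S * poly P (y a + sum y S))
      = (\<Sum>S\<in>Pow A. ?s S * poly ?Q (sum y S))"
    by (simp add: poly_pcompose algebra_simps sum_subtractf)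
  also have "\<dots> = fact (card A) * coeff ?Q (card A) * prod y A"
    by (rule insert.IH[OF d(1)])
  finally show ?case
    unfolding d(2) card_insert_disjoint[OF insert.hyps] prod.insert[OF insert.hyps] fact_Suc
    by (simp only: mult_ac)
qed

text \<open>The weight k^m clears the mean: k^m times (t + mean)^m is the m-th power of the sum of t
  + u over the subset. What remains is the alternating subset sum of x^m, whose leading coefficient
  is 1.\<close>

lemma polar_linear_power:
  assumes "us \<noteq> []"
  shows "polar (poly ([:t, 1:] ^ length us)) us = (\<Prod>u\<leftarrow>us. t + u)"
proof -
  define m where "m = length us"
  have m: "m > 0" using assms by (simp add: m_def)
  let ?g = "\<lambda>S. (- 1) ^ (m - card S) * poly (monom 1 m) (\<Sum>r\<in>S. t + us ! r)"
  have "(\<Sum>S | S \<noteq> {} \<and> S \<subseteq> {..<m}. (- 1) ^ (m - card S) * real (card S) ^ m *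
      poly ([:t, 1:] ^ m) (1 / real (card S) * (\<Sum>r\<in>S. us ! r)))
    = (\<Sum>S | S \<noteq> {} \<and> S \<subseteq> {..<m}. ?g S)"
  proof (intro sum.cong refl)
    fix S assume "S \<in> {S. S \<noteq> {} \<and> S \<subseteq> {..<m}}"
    then have "card S > 0" by (auto simp: card_gt_0_iff intro: finite_subset)
    then show "(- 1) ^ (m - card S) * real (card S) ^ m *
      poly ([:t, 1:] ^ m) (1 / real (card S) * (\<Sum>r\<in>S. us ! r)) = ?g S"
      by (simp add: poly_monom sum.distrib power_mult_distrib[symmetric] field_simps)
  qed
  \<comment> \<open>The empty set may be added because x^m vanishes at 0 for m > 0.\<close>
  also have "\<dots> = (\<Sum>S\<in>Pow {..<m}. ?g S)"
    by (rule sum.mono_neutral_left) (use m in \<open>auto simp: poly_monom\<close>)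
  also have "\<dots> = fact m * (\<Prod>r<m. t + us ! r)"
    using sum_alternating_subsets_poly[of "{..<m}" "monom 1 m" "\<lambda>r. t + us ! r"]
    by (simp add: degree_monom_le)
  also have "(\<Prod>r<m. t + us ! r) = (\<Prod>u\<leftarrow>us. t + u)"
    by (simp add: prod.list_conv_set_nth m_def atLeast0LessThan)
  finally show ?thesis
    by (simp add: polar_def m_def Let_def)
qed

text \<open>As a function of t, F((x + t)^m) is a polynomial with coefficients binom(m, i) F(x^i).
  It vanishes for every t, so every F(x^i) with i \<le> m is zero.\<close>

lemma linear_functional_vanishes_on_polys:
  fixes F :: "real poly \<Rightarrow> real"
  assumes add: "\<And>p q. F (p + q) = F p + F q" and scale: "\<And>c p. F (smult c p) = c * F p"
    and vanish: "\<And>t. F ([:t, 1:] ^ m) = 0" and deg: "degree p \<le> m"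
  shows "F p = 0"
proof -
  have F0: "F 0 = 0" using scale[of 0 0] by simp
  have F_sum: "F (sum g I) = (\<Sum>i\<in>I. F (g i))" for g :: "nat \<Rightarrow> real poly" and I
    by (induction I rule: infinite_finite_induct) (auto simp: F0 add)
  have expand: "[:t, 1:] ^ m = (\<Sum>i\<le>m. smult (real (m choose i) * t ^ (m - i)) (monom 1 i))" for t :: real
    by (subst poly_as_sum_of_monoms'[of _ m, symmetric])
       (auto simp: coeff_linear_poly_power smult_monom degree_power_le[THEN order_trans] intro!: sum.cong)
  define g where "g = (\<Sum>i\<le>m. monom (real (m choose i) * F (monom 1 i)) (m - i))"
  have "poly g t = 0" for t
    using vanish[of t] unfolding expand F_sum scale g_def
    by (simp add: poly_sum poly_monom mult_ac)
  then have g0: "g = 0" using poly_all_0_iff_0 by blast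
  have mono: "F (monom 1 i) = 0" if "i \<le> m" for i
  proof -
    have "coeff g (m - i) = (\<Sum>k\<le>m. if k = i then real (m choose k) * F (monom 1 k) else 0)"
      unfolding g_def coeff_sum using that by (intro sum.cong) auto
    with g0 that show ?thesis by simp
  qed
  have "F p = (\<Sum>i\<le>m. coeff p i * F (monom 1 i))"
    by (subst poly_as_sum_of_monoms'[OF deg, symmetric], subst F_sum)
       (simp add: scale[symmetric] smult_monom)
  with mono show ?thesis by simp
qed

subsection \<open>Bernstein sums\<close>

lemma poly_higher_pderiv_eq_coeff:
  fixes p :: "real poly"
  shows "poly ((pderiv ^^ j) p) 0 = fact j * coeff p j"
  by (simp add: poly_0_coeff_0 coeff_higher_pderiv pochhammer_fact[symmetric])

lemma higher_pderiv_pcompose_linear: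
  fixes p :: "real poly"
  shows "(pderiv ^^ j) (pcompose p [:c, d:]) = smult (d ^ j) (pcompose ((pderiv ^^ j) p) [:c, d:])"
  by (induction j) (simp_all add: pderiv_smult pderiv_pcompose pderiv_pCons mult.commute)

text \<open>Turns derivative conditions at \<open>u\<close> into conditions on the coefficients of
  the shifted polynomial.\<close>

lemma poly_higher_pderiv_taylor:
  fixes p :: "real poly"
  shows "poly ((pderiv ^^ j) p) u = fact j * coeff (pcompose p [:u, 1:]) j"
  using poly_higher_pderiv_eq_coeff[of j "pcompose p [:u, 1:]"]
  by (simp add: higher_pderiv_pcompose_linear poly_pcompose)

lemma higher_deriv_poly: "(deriv ^^ j) (poly p) = poly ((pderiv ^^ j) (p :: real poly))"
  by (induction j) (auto intro!: DERIV_imp_deriv)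

text \<open>A polynomial object lets iterated \<open>deriv\<close> be computed as iterated
  \<open>pderiv\<close>.\<close>

definition bernstein_poly :: "real \<Rightarrow> real \<Rightarrow> nat \<times> nat \<Rightarrow> real poly" where
  "bernstein_poly A B = (\<lambda>(k, l).
     smult (fact (k + l) / (fact k * fact l) / (B - A) ^ (k + l)) ([:B, -1:] ^ k * [:- A, 1:] ^ l))"

lemma poly_bernstein_poly: "poly (bernstein_poly A B \<alpha>) = bernstein_on A B \<alpha>"
  by (auto simp: fun_eq_iff bernstein_poly_def bernstein_on_def split: prod.splits)

lemma multi_indices_image: "multi_indices d = (\<lambda>k. (k, d - k)) ` {..d}"
  by (auto simp: multi_indices_def image_iff)

lemma finite_multi_indices [simp]: "finite (multi_indices d)"
  by (simp add: multi_indices_image)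

lemma sum_multi_indices: "(\<Sum>\<alpha>\<in>multi_indices d. f \<alpha>) = (\<Sum>k\<le>d. f (k, d - k))"
  unfolding multi_indices_image by (subst sum.reindex) (auto simp: inj_on_def)

text \<open>Apply the binomial theorem to (t + A)(B - x) + (t + B)(x - A) = (t + x)(B - A). In other
  words, (t + A)^k (t + B)^l are the Bernstein coefficients of (t + x)^d.\<close>

lemma sum_bernstein_blossom:
  assumes "A \<noteq> B"
  shows "(\<Sum>(k, l)\<in>multi_indices d. (t + A) ^ k * (t + B) ^ l * bernstein_on A B (k, l) x) = (t + x) ^ d"
proof -
  have "(\<Sum>(k, l)\<in>multi_indices d. (t + A) ^ k * (t + B) ^ l * bernstein_on A B (k, l) x)
    = (\<Sum>k\<le>d. real (d choose k) * ((t + A) * (B - x)) ^ k * ((t + B) * (x - A)) ^ (d - k)) / (B - A) ^ d"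
    unfolding sum_multi_indices sum_divide_distrib
    by (intro sum.cong) (auto simp: bernstein_on_def binomial_fact power_mult_distrib)
  also have "\<dots> = ((t + A) * (B - x) + (t + B) * (x - A)) ^ d / (B - A) ^ d"
    by (simp add: binomial_ring)
  also have "(t + A) * (B - x) + (t + B) * (x - A) = (t + x) * (B - A)"
    by (simp add: algebra_simps)
  finally show ?thesis using assms by (simp add: power_mult_distrib)
qed

text \<open>The affine map \<open>w \<mapsto> u + c * w\<close> carries \<open>[A - u, B - u]\<close> to \<open>[c * A + (1 - c) * u, c * B + (1 - c) * u]\<close>
  and \<open>0\<close> to \<open>u\<close>.\<close>

lemma higher_deriv_bernstein_rescale:
  assumes "c \<noteq> 0" 
  shows "c ^ j * (deriv ^^ j) (bernstein_on (c * A + (1 - c) * u) (c * B + (1 - c) * u) \<alpha>) u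
    = (deriv ^^ j) (bernstein_on A B \<alpha>) u"
proof -
  let ?b = "bernstein_poly (c * A + (1 - c) * u) (c * B + (1 - c) * u) \<alpha>"
  have "poly (pcompose ?b [:u, c:]) w = poly (pcompose (bernstein_poly A B \<alpha>) [:u, 1:]) w" for w
  proof -
    \<comment> \<open>All three linear factors scale by \<open>c\<close>, and the Bernstein quotient
      is homogeneous of degree 0 in them, so \<open>c\<close> cancels.\<close>
    have "c * B + (1 - c) * u - (u + c * w) = c * (B - (u + w))"
      "u + c * w - (c * A + (1 - c) * u) = c * (u + w - A)"
      "c * B + (1 - c) * u - (c * A + (1 - c) * u) = c * (B - A)"
      by (simp_all add: algebra_simps)
    then show ?thesis
      using assms
      by (cases \<alpha>) (simp add: poly_pcompose poly_bernstein_poly bernstein_on_def mult.commute[of _ c]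
          power_mult_distrib power_add)
  qed
  then have "pcompose ?b [:u, c:] = pcompose (bernstein_poly A B \<alpha>) [:u, 1:]"
    by (simp add: poly_eq_poly_eq_iff[symmetric] fun_eq_iff)
  then have "poly ((pderiv ^^ j) (pcompose ?b [:u, c:])) 0
      = poly ((pderiv ^^ j) (pcompose (bernstein_poly A B \<alpha>) [:u, 1:])) 0"
    by simp
  then show ?thesis
    by (simp add: higher_pderiv_pcompose_linear poly_pcompose poly_bernstein_poly[symmetric] higher_deriv_poly)
qed

lemma polar_linear:
  "polar (poly (p + q)) us = polar (poly p) us + polar (poly q) us"
  "polar (poly (smult c p)) us = c * polar (poly p) us"
  by (simp_all add: polar_def Let_def algebra_simps sum.distrib sum_distrib_left)

text \<open>The quotient of binomials compensates for the Bernstein basis having degree m - 1 only: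
  after the extra factor t + u, it turns the Taylor coefficient binom(m - 1, j) (t + u)^(m - 1 - j)
  of (t + x)^(m - 1) at \<open>u\<close> into that of (t + x)^m.\<close>

lemma sum_polar_bernstein_derivs:
  assumes "A \<noteq> B" "m \<ge> 1" "j \<le> m - 1" "degree p \<le> m"
  shows "(\<Sum>(k, l)\<in>multi_indices (m - 1).
      polar (poly p) (u # replicate k A @ replicate l B) *
      (real (m choose j) / real ((m - 1) choose j) * (deriv ^^ j) (bernstein_on A B (k, l)) u))
    = poly ((pderiv ^^ j) p) u"
proof -
  let ?\<rho> = "real (m choose j) / real ((m - 1) choose j)"
  let ?D = "\<lambda>\<alpha>. (deriv ^^ j) (bernstein_on A B \<alpha>) u"
  define F where "F p = (\<Sum>(k, l)\<in>multi_indices (m - 1).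
      polar (poly p) (u # replicate k A @ replicate l B) * (?\<rho> * ?D (k, l)))
    - poly ((pderiv ^^ j) p) u" for p
  have "F p = 0"
  proof (rule linear_functional_vanishes_on_polys[OF _ _ _ assms(4)])
    show "F (p + q) = F p + F q" for p q
      by (simp add: F_def polar_linear higher_pderiv_add algebra_simps sum.distrib split_def)
    show "F (smult c p) = c * F p" for c p
      by (simp add: F_def polar_linear higher_pderiv_smult algebra_simps sum_distrib_left split_def)
    fix t
    let ?P = "[:t, 1:] :: real poly"
    have "(\<Sum>(k, l)\<in>multi_indices (m - 1).
        polar (poly (?P ^ m)) (u # replicate k A @ replicate l B) * (?\<rho> * ?D (k, l)))
      = (\<Sum>(k, l)\<in>multi_indices (m - 1).
        (t + u) * ?\<rho> * ((t + A) ^ k * (t + B) ^ l * ?D (k, l)))"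
    proof (intro sum.cong refl, clarify)
      fix k l assume "(k, l) \<in> multi_indices (m - 1)"
      then have "m = length (u # replicate k A @ replicate l B)"
        using assms by (auto simp: multi_indices_def)
      then have "polar (poly (?P ^ m)) (u # replicate k A @ replicate l B) =
          (t + u) * ((t + A) ^ k * (t + B) ^ l)"
        using polar_linear_power[of "u # replicate k A @ replicate l B" t] by (simp del: replicate_Suc)
      then show "polar (poly (?P ^ m)) (u # replicate k A @ replicate l B) * (?\<rho> * ?D (k, l))
          = (t + u) * ?\<rho> * ((t + A) ^ k * (t + B) ^ l * ?D (k, l))"
        by simp
    qed
    also have "\<dots> = (t + u) * ?\<rho> *
        poly ((pderiv ^^ j) (\<Sum>(k, l)\<in>multi_indices (m - 1).
          smult ((t + A) ^ k * (t + B) ^ l) (bernstein_poly A B (k, l)))) u"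
      by (simp add: sum_distrib_left higher_pderiv_sum poly_sum split_def higher_pderiv_smult
          poly_bernstein_poly[symmetric] higher_deriv_poly)
    also have "(\<Sum>(k, l)\<in>multi_indices (m - 1).
          smult ((t + A) ^ k * (t + B) ^ l) (bernstein_poly A B (k, l))) = ?P ^ (m - 1)"
      using sum_bernstein_blossom[where d = "m - 1" and t = t, OF assms(1)]
      by (simp add: poly_eq_poly_eq_iff[symmetric] fun_eq_iff poly_sum split_def poly_bernstein_poly)
    also have "(t + u) * ?\<rho> * poly ((pderiv ^^ j) (?P ^ (m - 1))) u = poly ((pderiv ^^ j) (?P ^ m)) u"
    proof -
      have pc: "pcompose (?P ^ k) [:u, 1:] = [:t + u, 1:] ^ k" for k
        by (simp add: poly_eq_poly_eq_iff[symmetric] fun_eq_iff poly_pcompose add.assoc)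
      \<comment> \<open>The bound j \<le> m - 1 supplies the exponent for the extra factor t + u and
        keeps the denominator nonzero.\<close>
      have "m - j = Suc (m - 1 - j)" "(m - 1) choose j > 0" using assms by auto
      then show ?thesis
        using assms by (simp add: poly_higher_pderiv_taylor pc coeff_linear_poly_power)
    qed
    finally show "F (?P ^ m) = 0"
      by (simp only: F_def right_minus_eq)
  qed
  then show ?thesis by (simp add: F_def)
qed

text \<open>The power of \<open>theta\<close> in \<open>gam\<close> undoes the shrinking of the
  Bernstein interval towards \<open>v i\<close>. After rescaling, the interval has as its ends the
  split points at which \<open>nu\<close> evaluates the polar form.\<close>

lemma sum_nu_gam:
  assumes "\<phi> i \<ge> 2" "\<zeta> (int i - 1) \<noteq> \<zeta> (int i)" "j \<le> \<phi> i - 1" "degree p \<le> \<phi> i"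
  shows "(\<Sum>\<alpha>\<in>multi_indices (\<phi> i - 1). nu v \<zeta> i \<alpha> (poly p) * gam v \<zeta> \<phi> i \<alpha> j)
    = poly ((pderiv ^^ j) p) (v i)"
proof -
  have "theta \<phi> i \<noteq> 0" using assms(1) by (simp add: theta_def)
  then have "gam v \<zeta> \<phi> i \<alpha> j = real (\<phi> i choose j) / real ((\<phi> i - 1) choose j) *
      (deriv ^^ j) (bernstein_on (\<zeta> (int i - 1)) (\<zeta> (int i)) \<alpha>) (v i)" for \<alpha>
    unfolding gam_def S1_def S2_def mult.assoc
    by (simp add: higher_deriv_bernstein_rescale)
  then show ?thesis
    using sum_polar_bernstein_derivs[OF assms(2) _ assms(3,4), of "v i"] assms(1)
    by (simp add: nu_def split_def)
qed

subsection \<open>Hermite interpolation by two pieces\<close>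

lemma poly_shift: "poly p x = poly (pcompose p [:u, 1:]) (x - u)" for p :: "real poly"
  by (simp add: poly_pcompose)

text \<open>In the Taylor expansion at \<open>u\<close>, the derivatives kill the coefficients below
  \<open>m\<close> and the degree bound kills those above.\<close>

lemma poly_vanishing_derivs:
  fixes p :: "real poly"
  assumes "degree p \<le> m" "\<And>j. j < m \<Longrightarrow> poly ((pderiv ^^ j) p) u = 0"
  shows "\<exists>c. p = smult c ([:- u, 1:] ^ m)"
proof -
  let ?q = "pcompose p [:u, 1:]"
  have "coeff ?q j = 0" if "j \<noteq> m" for j
  proof (cases "j < m")
    case True
    then show ?thesis using assms(2)[of j] by (simp add: poly_higher_pderiv_taylor)
  next
    case False
    with that assms(1) show ?thesis by (intro coeff_eq_0) (simp add: degree_pcompose)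
  qed
  then have "?q = monom (coeff ?q m) m"
    by (simp add: poly_eq_iff)
  then have "poly p x = coeff ?q m * (x - u) ^ m" for x
    using poly_shift[of p x u] by (metis poly_monom)
  then have "p = smult (coeff ?q m) ([:- u, 1:] ^ m)"
    by (simp add: poly_eq_poly_eq_iff[symmetric] fun_eq_iff)
  then show ?thesis ..
qed

lemma poly_with_derivs:
  fixes f :: "nat \<Rightarrow> real"
  shows "\<exists>p. degree p \<le> m \<and> (\<forall>j<m. poly ((pderiv ^^ j) p) u = f j)"
proof -
  let ?q = "\<Sum>i<m. monom (f i / fact i) i"
  let ?p = "pcompose ?q [:- u, 1:]"
  have "degree ?q \<le> m"
    by (intro degree_sum_le) (auto intro: degree_monom_le[THEN order_trans])
  moreover have "pcompose ?p [:u, 1:] = ?q"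
    by (simp add: poly_eq_poly_eq_iff[symmetric] fun_eq_iff poly_pcompose)
  moreover have "coeff ?q j = f j / fact j" if "j < m" for j
    using that by (simp add: coeff_sum)
  ultimately show ?thesis
    by (intro exI[of _ ?p]) (simp add: poly_higher_pderiv_taylor degree_pcompose)
qed

lemma higher_pderiv_linear_power_less:
  fixes u c :: real
  assumes "j < m"
  shows "poly ((pderiv ^^ j) (smult c ([:- u, 1:] ^ m))) u = 0"
proof -
  have "pcompose (smult c ([:- u, 1:] ^ m)) [:u, 1:] = monom c m"
    by (simp add: poly_eq_poly_eq_iff[symmetric] fun_eq_iff poly_pcompose poly_monom)
  then show ?thesis using assms by (simp add: poly_higher_pderiv_taylor)
qed

lemma smooth_join_1: "smooth_join 1 z P Q \<longleftrightarrow> poly P z = poly Q z \<and> poly (pderiv P) z = poly (pderiv Q) z"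
  by (auto simp: smooth_join_def le_Suc_eq)

text \<open>The interpolation problem on one cell with vertices \<open>u\<close>, \<open>w\<close>
  and split point \<open>z\<close>. The data leave one free parameter in each piece, and the two
  conditions of the C^1 join at \<open>z\<close> fix these parameters.\<close>

definition hermite_pair ::
    "real \<Rightarrow> real \<Rightarrow> real \<Rightarrow> nat \<Rightarrow> nat \<Rightarrow> (nat \<Rightarrow> real) \<Rightarrow> (nat \<Rightarrow> real) \<Rightarrow> real poly \<Rightarrow> real poly \<Rightarrow> bool" where
  "hermite_pair u z w m m' f g P Q \<longleftrightarrow> degree P \<le> m \<and> degree Q \<le> m' \<and>
     (\<forall>j<m. poly ((pderiv ^^ j) P) u = f j) \<and> (\<forall>j<m'. poly ((pderiv ^^ j) Q) w = g j) \<and>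
     smooth_join 1 z P Q"

text \<open>Superposition takes place on the polynomial pieces of a cell, so that a combination of
  splines can be identified through its pieces.\<close>

lemma hermite_pair_sum:
  assumes "finite I" "\<And>i. i \<in> I \<Longrightarrow> hermite_pair u z w m m' (f i) (g i) (P i) (Q i)"
  shows "hermite_pair u z w m m' (\<lambda>j. \<Sum>i\<in>I. c i * f i j) (\<lambda>j. \<Sum>i\<in>I. c i * g i j)
    (\<Sum>i\<in>I. smult (c i) (P i)) (\<Sum>i\<in>I. smult (c i) (Q i))"
  using assms
  by (auto simp: hermite_pair_def smooth_join_def higher_pderiv_sum higher_pderiv_smult poly_sum
      intro!: degree_sum_le degree_smult_le[THEN order_trans] sum.cong)

text \<open>This is the determinant of the system that matches c (x - u)^m and d (x - w)^m' to first
  order at \<open>z\<close>, with X = z - u and Y = z - w. Once the powers are factored out, both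
  remaining terms have the same strict sign.\<close>

lemma hermite_pair_det:
  fixes X Y :: real
  assumes "X > 0" "Y < 0" "m \<ge> 1" "m' \<ge> 1"
  shows "Y ^ m' * (real m * X ^ (m - 1)) - X ^ m * (real m' * Y ^ (m' - 1)) \<noteq> 0"
proof -
  have "Y ^ m' * (real m * X ^ (m - 1)) - X ^ m * (real m' * Y ^ (m' - 1))
      = X ^ (m - 1) * Y ^ (m' - 1) * (real m * Y - real m' * X)"
    using assms by (simp add: power_eq_if algebra_simps)
  moreover have "real m * Y < real m' * X"
    by (rule less_trans[of _ 0]) (use assms in \<open>auto simp: mult_less_0_iff\<close>)
  ultimately show ?thesis using assms by simp
qed

lemma pderiv_linear_power: "poly (pderiv (smult c ([:- u, 1:] ^ m))) z = c * (real m * (z - u) ^ (m - 1))"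
  by (simp add: pderiv_smult pderiv_power pderiv_pCons)

text \<open>The differences of two solutions have zero data, so they are multiples of (x - u)^m and
  (x - w)^m'. The C^1 join gives a homogeneous system for the two factors, with nonzero
  determinant.\<close>

lemma hermite_pair_unique:
  assumes uzw: "u < z" "z < w" and m: "m \<ge> 1" "m' \<ge> 1"
    and 1: "hermite_pair u z w m m' f g P1 Q1" and 2: "hermite_pair u z w m m' f g P2 Q2"
  shows "P1 = P2 \<and> Q1 = Q2"
proof -
  have diff: "(pderiv ^^ j) (p - q) = (pderiv ^^ j) p - (pderiv ^^ j) q" for j and p q :: "real poly"
    by (induction j) (simp_all add: pderiv_diff)
  obtain c where c: "P1 - P2 = smult c ([:- u, 1:] ^ m)"
    using poly_vanishing_derivs[of "P1 - P2" m u] 1 2 by (auto simp: hermite_pair_def diff degree_diff_le)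
  obtain d where d: "Q1 - Q2 = smult d ([:- w, 1:] ^ m')"
    using poly_vanishing_derivs[of "Q1 - Q2" m' w] 1 2 by (auto simp: hermite_pair_def diff degree_diff_le)
  have J: "poly (P1 - P2) z = poly (Q1 - Q2) z" "poly (pderiv (P1 - P2)) z = poly (pderiv (Q1 - Q2)) z"
    using 1 2 unfolding hermite_pair_def smooth_join_1 by (auto simp: pderiv_diff)
  let ?a1 = "(z - u) ^ m" and ?b1 = "(z - w) ^ m'"
  let ?a2 = "real m * (z - u) ^ (m - 1)" and ?b2 = "real m' * (z - w) ^ (m' - 1)"
  have e: "c * ?a1 = d * ?b1" "c * ?a2 = d * ?b2"
    using J unfolding c d pderiv_linear_power by simp_all
  have "c * (?b1 * ?a2 - ?a1 * ?b2) = ?b1 * (c * ?a2) - c * ?a1 * ?b2" by algebra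
  also have "\<dots> = 0" unfolding e by algebra
  finally have "c = 0"
    using hermite_pair_det[of "z - u" "z - w" m m'] uzw m by simp
  moreover have "d = 0" using e(1) \<open>c = 0\<close> uzw by simp
  ultimately show ?thesis using c d by simp
qed

text \<open>Start from polynomials with the prescribed derivatives at the vertices and correct them
  by multiples of (x - u)^m and (x - w)^m', which leave those derivatives unchanged.\<close>

lemma hermite_pair_exists:
  assumes uzw: "u < z" "z < w" and m: "m \<ge> 1" "m' \<ge> 1"
  shows "\<exists>P Q. hermite_pair u z w m m' f g P Q"
proof -
  obtain P0 where P0: "degree P0 \<le> m" "\<And>j. j < m \<Longrightarrow> poly ((pderiv ^^ j) P0) u = f j"
    using poly_with_derivs by blast
  obtain Q0 where Q0: "degree Q0 \<le> m'" "\<And>j. j < m' \<Longrightarrow> poly ((pderiv ^^ j) Q0) w = g j"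
    using poly_with_derivs by blast
  define a1 where "a1 = (z - u) ^ m"
  define b1 where "b1 = (z - w) ^ m'"
  define a2 where "a2 = real m * (z - u) ^ (m - 1)"
  define b2 where "b2 = real m' * (z - w) ^ (m' - 1)"
  define r1 where "r1 = poly Q0 z - poly P0 z"
  define r2 where "r2 = poly (pderiv Q0) z - poly (pderiv P0) z"
  define D where "D = b1 * a2 - a1 * b2"
  have D: "D \<noteq> 0"
    using hermite_pair_det[of "z - u" "z - w" m m'] uzw m by (simp add: D_def a1_def a2_def b1_def b2_def)
  \<comment> \<open>Cramer's rule, where \<open>r1\<close> and \<open>r2\<close> are the mismatches
    of value and slope at \<open>z\<close>.\<close>
  define c where "c = (b1 * r2 - b2 * r1) / D"
  define d where "d = (a1 * r2 - a2 * r1) / D"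
  have "c * a1 - d * b1 = r1 * D / D" "c * a2 - d * b2 = r2 * D / D"
    unfolding c_def d_def times_divide_eq_left diff_divide_distrib[symmetric]
    by (simp_all add: D_def algebra_simps)
  then have e: "c * a1 - d * b1 = r1" "c * a2 - d * b2 = r2"
    using D by simp_all
  let ?P = "P0 + smult c ([:- u, 1:] ^ m)" and ?Q = "Q0 + smult d ([:- w, 1:] ^ m')"
  have deg: "degree (smult x ([:y, 1:] ^ k)) \<le> k" for x y :: real and k
    using degree_smult_le[of x "[:y, 1:] ^ k"] degree_power_le[of "[:y, 1:]" k] by simp
  have "smooth_join 1 z ?P ?Q"
    using e unfolding smooth_join_1 pderiv_add poly_add pderiv_linear_power
    by (simp add: r1_def r2_def a1_def a2_def b1_def b2_def algebra_simps)
  then have "hermite_pair u z w m m' f g ?P ?Q"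
    using P0 Q0 deg by (simp add: hermite_pair_def degree_add_le higher_pderiv_add
        higher_pderiv_linear_power_less)
  then show ?thesis by blast
qed

section \<open>Derivatives of functions glued from two polynomials\<close>

lemma DERIV_two_pieces:
  fixes P Q :: "real poly"
  assumes "poly P c = poly Q c" "poly (pderiv P) c = poly (pderiv Q) c"
  shows "((\<lambda>x. if x \<le> c then poly P x else poly Q x) has_real_derivative
    (if x \<le> c then poly (pderiv P) x else poly (pderiv Q) x)) (at x)"
proof -
  \<comment> \<open>The two closures meet only in \<open>c\<close>, so the gluing rule asks for
    agreement of values and slopes only there.\<close>
  have cl: "closure {..c} = {..c}" "closure {c<..} = {c..}" by simp_all
  have "((\<lambda>x. if x \<in> {..c} then poly P x else poly Q x) has_vector_derivative
    (if x \<in> {..c} then poly (pderiv P) x else poly (pderiv Q) x)) (at x within UNIV)"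
    using assms cl
    by (intro has_vector_derivative_If_within_closures[where S = "{..c}" and T = "{c<..}" and f' = "poly (pderiv P)"
          and g' = "poly (pderiv Q)"])
       (auto simp: has_real_derivative_iff_has_vector_derivative[symmetric] intro: DERIV_subset[OF poly_DERIV])
  then show ?thesis
    by (simp add: has_real_derivative_iff_has_vector_derivative)
qed

text \<open>By induction, near \<open>x\<close> the j-th derivative is the function glued from the
  j-th derivatives of the pieces, and the join of order \<open>r\<close> lets it be differentiated
  once more while j < r. The bounds \<open>l\<close> and \<open>u\<close> may lie outside [a,b], so
  the endpoints of the domain are covered as well.\<close>

lemma nth_deriv_within_two_pieces:
  fixes P Q :: "real poly"
  assumes ab: "a < b" and lu: "l < c" "c < u"
    and left: "\<And>x. x \<in> {a..b} \<Longrightarrow> l < x \<Longrightarrow> x \<le> c \<Longrightarrow> s x = poly P x"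
    and right: "\<And>x. x \<in> {a..b} \<Longrightarrow> c \<le> x \<Longrightarrow> x < u \<Longrightarrow> s x = poly Q x"
    and join: "smooth_join r c P Q" and "j \<le> r" and "x \<in> {a..b}" "l < x" "x < u"
  shows "nth_deriv_within {a..b} j s x
    = (if x \<le> c then poly ((pderiv ^^ j) P) x else poly ((pderiv ^^ j) Q) x)"
  using \<open>j \<le> r\<close> \<open>x \<in> {a..b}\<close> \<open>l < x\<close> \<open>x < u\<close>
proof (induction j arbitrary: x)
  case 0
  then show ?case using left right by (simp add: nth_deriv_within_def)
next
  case (Suc j)
  let ?P = "(pderiv ^^ j) P" and ?Q = "(pderiv ^^ j) Q"
  let ?D = "if x \<le> c then poly (pderiv ?P) x else poly (pderiv ?Q) x"
  have J: "poly ?P c = poly ?Q c" "poly (pderiv ?P) c = poly (pderiv ?Q) c"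
    using join Suc.prems(1) unfolding smooth_join_def by (auto dest: spec[of _ j] spec[of _ "Suc j"])
  define e where "e = min (x - l) (u - x)"
  have "(nth_deriv_within {a..b} j s has_vector_derivative ?D) (at x within {a..b})"
  proof (rule has_vector_derivative_transform_within)
    show "((\<lambda>x. if x \<le> c then poly ?P x else poly ?Q x) has_vector_derivative ?D) (at x within {a..b})"
      using DERIV_two_pieces[OF J, of x]
      by (auto simp: has_real_derivative_iff_has_vector_derivative intro: has_vector_derivative_at_within)
    show "0 < e" using Suc.prems by (simp add: e_def)
    show "(if x' \<le> c then poly ?P x' else poly ?Q x') = nth_deriv_within {a..b} j s x'"
      if "x' \<in> {a..b}" "dist x' x < e" for x'
    proof -
      have "l < x'" "x' < u" using that(2) by (auto simp: e_def dist_real_def)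
      then show ?thesis using Suc.IH[of x'] Suc.prems(1) that(1) by simp
    qed
  qed (use Suc.prems in auto)
  then have "vector_derivative (nth_deriv_within {a..b} j s) (at x within {a..b}) = ?D"
    by (rule vector_derivative_within_closed_interval[OF ab Suc.prems(2)])
  then show ?case by (simp add: nth_deriv_within_def)
qed

subsection \<open>Splines\<close>

locale split_partition =
  fixes n :: nat and v :: "nat \<Rightarrow> real" and \<zeta> :: "int \<Rightarrow> real" and \<phi> :: "nat \<Rightarrow> nat"
  assumes n_ge_1: "n \<ge> 1"
    and v_less: "i < n \<Longrightarrow> v i < v (Suc i)"
    and zeta_in: "i < n \<Longrightarrow> \<zeta> (int i) \<in> {v i<..<v (Suc i)}"
    and zeta_first: "\<zeta> (- 1) = v 0" and zeta_last: "\<zeta> (int n) = v n"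
    and phi_ge_2: "i \<le> n \<Longrightarrow> \<phi> i \<ge> 2"
begin

lemma v_mono: "i \<le> j \<Longrightarrow> j \<le> n \<Longrightarrow> v i \<le> v j"
proof (induction j rule: dec_induct)
  case (step k)
  then show ?case using v_less[of k] by simp
qed simp

lemma v_strict_mono: "i < j \<Longrightarrow> j \<le> n \<Longrightarrow> v i < v j"
  using v_less[of i] v_mono[of "Suc i" j] by simp

lemma endpoints_less: "v 0 < v n"
  using v_strict_mono[of 0 n] n_ge_1 by simp

lemma zeta_gt: "i < n \<Longrightarrow> v i < \<zeta> (int i)" and zeta_lt: "i < n \<Longrightarrow> \<zeta> (int i) < v (Suc i)"
  using zeta_in[of i] by auto

text \<open>Only \<open>R 0, L 1, R 1, \<dots>, R (n - 1), L n\<close> occur: the pieces \<open>L 0\<close> and \<open>R n\<close> live on degenerate intervals.\<close>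

definition pieces :: "(real \<Rightarrow> real) \<Rightarrow> (nat \<Rightarrow> real poly) \<Rightarrow> (nat \<Rightarrow> real poly) \<Rightarrow> bool" where
  "pieces s L R \<longleftrightarrow>
     (\<forall>i<n. degree (R i) \<le> \<phi> i \<and> degree (L (Suc i)) \<le> \<phi> (Suc i) \<and>
        (\<forall>x\<in>{v i..\<zeta> (int i)}. s x = poly (R i) x) \<and>
        (\<forall>x\<in>{\<zeta> (int i)..v (Suc i)}. s x = poly (L (Suc i)) x) \<and>
        smooth_join 1 (\<zeta> (int i)) (R i) (L (Suc i))) \<and>
     (\<forall>i. 0 < i \<and> i < n \<longrightarrow> smooth_join (\<phi> i - 1) (v i) (L i) (R i))"

lemma spline_space_iff_pieces:
  "s \<in> spline_space n v \<zeta> \<phi> \<longleftrightarrow> s \<in> extensional {v 0..v n} \<and> (\<exists>L R. pieces s L R)"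
proof
  assume "s \<in> spline_space n v \<zeta> \<phi>"
  then obtain L R where ext: "s \<in> extensional {v 0..v n}"
    and pc: "\<And>i. i \<le> n \<Longrightarrow> degree (L i) \<le> \<phi> i \<and> degree (R i) \<le> \<phi> i \<and>
        (\<zeta> (int i - 1) < v i \<longrightarrow> (\<forall>x\<in>{\<zeta> (int i - 1)..v i}. s x = poly (L i) x)) \<and>
        (v i < \<zeta> (int i) \<longrightarrow> (\<forall>x\<in>{v i..\<zeta> (int i)}. s x = poly (R i) x))"
    and jv: "\<And>i. 0 < i \<and> i < n \<Longrightarrow> smooth_join (\<phi> i - 1) (v i) (L i) (R i)"
    and jz: "\<And>i. i < n \<Longrightarrow> smooth_join 1 (\<zeta> (int i)) (R i) (L (Suc i))"
    unfolding spline_space_def by blast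
  have "pieces s L R"
    unfolding pieces_def
  proof (intro conjI allI impI)
    fix i assume i: "i < n"
    show "degree (R i) \<le> \<phi> i" "degree (L (Suc i)) \<le> \<phi> (Suc i)"
      "\<forall>x\<in>{v i..\<zeta> (int i)}. s x = poly (R i) x"
      "\<forall>x\<in>{\<zeta> (int i)..v (Suc i)}. s x = poly (L (Suc i)) x"
      "smooth_join 1 (\<zeta> (int i)) (R i) (L (Suc i))"
      using pc[of i] pc[of "Suc i"] jz[of i] i zeta_gt[of i] zeta_lt[of i] by auto
  qed (use jv in auto)
  with ext show "s \<in> extensional {v 0..v n} \<and> (\<exists>L R. pieces s L R)" by blast
next
  assume "s \<in> extensional {v 0..v n} \<and> (\<exists>L R. pieces s L R)"
  then obtain L R where ext: "s \<in> extensional {v 0..v n}" and pc: "pieces s L R" by blast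
  \<comment> \<open>\<open>pieces\<close> leaves \<open>L 0\<close> and \<open>R n\<close>
    arbitrary, whereas the spline space bounds their degrees; the zero polynomial satisfies the
    bounds.\<close>
  let ?L = "L(0 := 0)" and ?R = "R(n := 0)"
  have "degree (?L i) \<le> \<phi> i \<and> degree (?R i) \<le> \<phi> i \<and>
        (\<zeta> (int i - 1) < v i \<longrightarrow> (\<forall>x\<in>{\<zeta> (int i - 1)..v i}. s x = poly (?L i) x)) \<and>
        (v i < \<zeta> (int i) \<longrightarrow> (\<forall>x\<in>{v i..\<zeta> (int i)}. s x = poly (?R i) x))" if "i \<le> n" for i
  proof -
    have "degree (?L i) \<le> \<phi> i \<and> (\<zeta> (int i - 1) < v i \<longrightarrow> (\<forall>x\<in>{\<zeta> (int i - 1)..v i}. s x = poly (?L i) x))"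
      using pc that by (cases i) (auto simp: pieces_def zeta_first)
    moreover have "degree (?R i) \<le> \<phi> i \<and> (v i < \<zeta> (int i) \<longrightarrow> (\<forall>x\<in>{v i..\<zeta> (int i)}. s x = poly (?R i) x))"
      using pc that by (cases "i = n") (auto simp: pieces_def zeta_last)
    ultimately show ?thesis by blast
  qed
  moreover have "0 < i \<and> i < n \<longrightarrow> smooth_join (\<phi> i - 1) (v i) (?L i) (?R i)" for i
    using pc by (auto simp: pieces_def)
  moreover have "i < n \<longrightarrow> smooth_join 1 (\<zeta> (int i)) (?R i) (?L (Suc i))" for i
    using pc by (auto simp: pieces_def)
  ultimately show "s \<in> spline_space n v \<zeta> \<phi>"
    unfolding spline_space_def using ext by blast
qed

lemma between_breakpoints:
  assumes "x \<in> {v 0..v n}"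
  obtains i where "i < n" "x \<in> {v i..\<zeta> (int i)} \<or> x \<in> {\<zeta> (int i)..v (Suc i)}"
proof -
  \<comment> \<open>The first vertex not to the left of \<open>x\<close>: either x = v 0, or
    \<open>x\<close> lies in the cell that ends at this vertex.\<close>
  define k where "k = (LEAST k. x \<le> v k)"
  have k: "x \<le> v k" "k \<le> n"
    using assms by (auto simp: k_def intro: LeastI[of _ n] Least_le)
  show ?thesis
  proof (cases k)
    case 0
    with k assms have "x = v 0" by simp
    then show ?thesis using that[of 0] n_ge_1 zeta_gt[of 0] by force
  next
    case (Suc i)
    have "\<not> x \<le> v i" using not_less_Least[of i "\<lambda>k. x \<le> v k"] Suc by (simp add: k_def)
    then show ?thesis using that[of i] k Suc by force
  qed
qed

lemma nth_deriv_within_pieces: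
  assumes pc: "pieces s L R" and i: "i < n"
  shows "j \<le> \<phi> i - 1 \<Longrightarrow>
      nth_deriv_within {v 0..v n} j s (v i) = poly ((pderiv ^^ j) (R i)) (v i)"
    and "j \<le> \<phi> (Suc i) - 1 \<Longrightarrow>
      nth_deriv_within {v 0..v n} j s (v (Suc i)) = poly ((pderiv ^^ j) (L (Suc i))) (v (Suc i))"
proof -
  have refl: "smooth_join r c P P" for r c P by (simp add: smooth_join_def)
  have inner: "nth_deriv_within {v 0..v n} j s (v k) = poly ((pderiv ^^ j) (L k)) (v k) \<and>
      nth_deriv_within {v 0..v n} j s (v k) = poly ((pderiv ^^ j) (R k)) (v k)"
    if k: "0 < k" "k < n" and j: "j \<le> \<phi> k - 1" for j k
  proof -
    obtain k' where k': "k = Suc k'" using k(1) by (cases k) auto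
    have join: "smooth_join (\<phi> k - 1) (v k) (L k) (R k)" using pc k by (simp add: pieces_def)
    have "nth_deriv_within {v 0..v n} j s (v k) = (if v k \<le> v k then poly ((pderiv ^^ j) (L k)) (v k)
        else poly ((pderiv ^^ j) (R k)) (v k))"
      by (rule nth_deriv_within_two_pieces[OF endpoints_less _ _ _ _ join j, of "\<zeta> (int k')" "\<zeta> (int k)"])
         (use k k' pc zeta_gt[of k] zeta_lt[of k'] v_mono[of 0 k] v_mono[of k n] in \<open>auto simp: pieces_def\<close>)
    with join j show ?thesis by (simp add: smooth_join_def)
  qed
  show "nth_deriv_within {v 0..v n} j s (v i) = poly ((pderiv ^^ j) (R i)) (v i)" if j: "j \<le> \<phi> i - 1"
  proof (cases "i = 0")
    case False
    then show ?thesis using inner[of i j] i j by blast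
  next
    case True
    \<comment> \<open>At an endpoint the missing outer piece is replaced by the inner one. Only the
      endpoint itself lies on the outer side of the domain, so both pieces describe \<open>s\<close>
      there.\<close>
    have "nth_deriv_within {v 0..v n} j s (v 0) = (if v 0 \<le> v 0 then poly ((pderiv ^^ j) (R 0)) (v 0)
        else poly ((pderiv ^^ j) (R 0)) (v 0))"
      by (rule nth_deriv_within_two_pieces[OF endpoints_less _ _ _ _ refl order_refl, of "v 0 - 1" "v 0" "\<zeta> 0"])
         (use True i pc zeta_gt[of 0] endpoints_less in \<open>auto simp: pieces_def\<close>)
    with True show ?thesis by simp
  qed
  show "nth_deriv_within {v 0..v n} j s (v (Suc i)) = poly ((pderiv ^^ j) (L (Suc i))) (v (Suc i))"
    if j: "j \<le> \<phi> (Suc i) - 1"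
  proof (cases "Suc i = n")
    case True
    have "nth_deriv_within {v 0..v n} j s (v n) = (if v n \<le> v n then poly ((pderiv ^^ j) (L n)) (v n)
        else poly ((pderiv ^^ j) (L n)) (v n))"
      by (rule nth_deriv_within_two_pieces[OF endpoints_less _ _ _ _ refl order_refl, of "\<zeta> (int i)" "v n" "v n + 1"])
         (use True i pc zeta_lt[of i] endpoints_less in \<open>auto simp: pieces_def\<close>)
    with True show ?thesis by simp
  qed (use inner i j in auto)
qed

section \<open>Unique solvability of Hermite interpolation in the spline space\<close>

definition interpolates :: "(nat \<Rightarrow> nat \<Rightarrow> real) \<Rightarrow> (real \<Rightarrow> real) \<Rightarrow> bool" where
  "interpolates d s \<longleftrightarrow>
     (\<forall>k\<le>n. \<forall>j\<le>\<phi> k - 1. nth_deriv_within {v 0..v n} j s (v k) = d k j)"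

abbreviation hermite_at where
  "hermite_at d i \<equiv> hermite_pair (v i) (\<zeta> (int i)) (v (Suc i)) (\<phi> i) (\<phi> (Suc i)) (d i) (d (Suc i))"

lemma hermite_at_unique:
  "i < n \<Longrightarrow> hermite_at d i P Q \<Longrightarrow> hermite_at d i P' Q' \<Longrightarrow> P = P' \<and> Q = Q'"
  using zeta_gt[of i] zeta_lt[of i] phi_ge_2[of i] phi_ge_2[of "Suc i"]
  by (intro hermite_pair_unique) auto

lemma interpolates_pieces:
  assumes pc: "pieces s L R" and int: "interpolates d s" and i: "i < n"
  shows "hermite_at d i (R i) (L (Suc i))"
proof -
  have "j \<le> \<phi> i - 1" if "j < \<phi> i" for j i using that by simp
  then show ?thesis
    using pc int i nth_deriv_within_pieces[OF pc i]
    unfolding hermite_pair_def pieces_def interpolates_def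
    by (metis Suc_leI less_imp_le)
qed

text \<open>The cells decouple: the data at two adjacent vertices determine both pieces between
  them. Off the domain both functions are \<open>undefined\<close>.\<close>

lemma interpolates_unique:
  assumes "s \<in> spline_space n v \<zeta> \<phi>" "t \<in> spline_space n v \<zeta> \<phi>" "interpolates d s" "interpolates d t"
  shows "s = t"
proof
  fix x
  obtain L R L' R' where pc: "pieces s L R" "pieces t L' R'"
    using assms by (auto simp: spline_space_iff_pieces)
  have ext: "s \<in> extensional {v 0..v n}" "t \<in> extensional {v 0..v n}"
    using assms by (auto simp: spline_space_iff_pieces)
  show "s x = t x"
  proof (cases "x \<in> {v 0..v n}")
    case True
    then obtain i where i: "i < n" "x \<in> {v i..\<zeta> (int i)} \<or> x \<in> {\<zeta> (int i)..v (Suc i)}"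
      by (rule between_breakpoints)
    have "R i = R' i \<and> L (Suc i) = L' (Suc i)"
      using hermite_at_unique[OF i(1)] interpolates_pieces assms pc i(1) by blast
    then show ?thesis
      using i pc by (auto simp: pieces_def)
  qed (use ext in \<open>simp add: extensional_def\<close>)
qed

text \<open>Solve each cell separately. Neighbouring solutions join smoothly at their common vertex
  because both take the same data there.\<close>

lemma interpolates_exists: "\<exists>s\<in>spline_space n v \<zeta> \<phi>. interpolates d s"
proof -
  have "\<exists>P Q. i < n \<longrightarrow> hermite_at d i P Q" for i
    using hermite_pair_exists[of "v i" "\<zeta> (int i)" "v (Suc i)" "\<phi> i" "\<phi> (Suc i)" "d i" "d (Suc i)"]
      zeta_gt[of i] zeta_lt[of i] phi_ge_2[of i] phi_ge_2[of "Suc i"] by force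
  then obtain R L' where H: "\<And>i. i < n \<Longrightarrow> hermite_at d i (R i) (L' i)"
    by metis
  \<comment> \<open>The second polynomial of cell \<open>i\<close> is the piece to the left of
    vertex \<open>Suc i\<close>.\<close>
  define L where "L k = L' (k - 1)" for k
  have H: "hermite_at d i (R i) (L (Suc i))" if "i < n" for i
    using H[OF that] by (simp add: L_def)
  have join: "smooth_join (\<phi> i - 1) (v i) (L i) (R i)" if "0 < i" "i < n" for i
    using H[of i] H[of "i - 1"] that phi_ge_2[of i] unfolding hermite_pair_def smooth_join_def by simp
  \<comment> \<open>The cell containing \<open>x\<close>. An inner vertex is assigned to the cell on
    its left, so its value as a point of the right-hand cell must come from the join.\<close>
  define idx where "idx x = (LEAST i. x \<le> v (Suc i))" for x
  define s where "s = restrict (\<lambda>x. if x \<le> \<zeta> (int (idx x)) then poly (R (idx x)) x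
      else poly (L (Suc (idx x))) x) {v 0..v n}"
  have idx: "idx x = i" if "i < n" "x \<le> v (Suc i)" "v i < x \<or> i = 0" for x i
    unfolding idx_def
  proof (rule Least_equality)
    fix k assume "x \<le> v (Suc k)"
    then show "i \<le> k" using that v_mono[of "Suc k" i] by force
  qed (rule that)
  have in_dom: "x \<in> {v 0..v n}" if "i < n" "v i \<le> x" "x \<le> v (Suc i)" for x i
    using that v_mono[of 0 i] v_mono[of "Suc i" n] by auto
  have left: "s x = poly (L (Suc i)) x" if i: "i < n" and x: "x \<in> {\<zeta> (int i)..v (Suc i)}" for x i
  proof -
    have "idx x = i" "x \<in> {v 0..v n}"
      using idx[of i x] in_dom[of i x] zeta_gt[of i] i x by auto
    moreover have "poly (R i) (\<zeta> (int i)) = poly (L (Suc i)) (\<zeta> (int i))"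
      using H[OF i] by (simp add: hermite_pair_def smooth_join_1[unfolded One_nat_def])
    ultimately show ?thesis using x by (auto simp: s_def)
  qed
  have right: "s x = poly (R i) x" if i: "i < n" and x: "x \<in> {v i..\<zeta> (int i)}" for x i
  proof (cases "v i < x \<or> i = 0")
    case True
    then have "idx x = i" "x \<in> {v 0..v n}"
      using idx[of i x] in_dom[of i x] zeta_lt[of i] i x by auto
    then show ?thesis using x by (simp add: s_def)
  next
    case False
    then have xi: "x = v i" "0 < i" using x by auto
    then obtain k where k: "i = Suc k" by (cases i) auto
    have "s x = poly (L i) x"
      using left[of k x] xi i k zeta_lt[of k] by simp
    also have "\<dots> = poly (R i) x"
      using join[OF xi(2) i] by (auto simp: smooth_join_def xi dest: spec[of _ 0])
    finally show ?thesis .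
  qed
  have pc: "pieces s L R"
    unfolding pieces_def using H join left right by (auto simp: hermite_pair_def)
  have "interpolates d s"
    unfolding interpolates_def
  proof (intro allI impI)
    fix k j assume k: "k \<le> n" and j: "j \<le> \<phi> k - 1"
    have "j < \<phi> k" using j phi_ge_2[OF k] by simp
    show "nth_deriv_within {v 0..v n} j s (v k) = d k j"
    proof (cases "k < n")
      case True
      then show ?thesis
        using nth_deriv_within_pieces(1)[OF pc True j] H[OF True] \<open>j < \<phi> k\<close> by (simp add: hermite_pair_def)
    next
      case False
      with k n_ge_1 obtain i where "k = Suc i" "i < n" by (cases k) auto
      then show ?thesis
        using nth_deriv_within_pieces(2)[OF pc, of i j] j H[of i] \<open>j < \<phi> k\<close> by (simp add: hermite_pair_def)
    qed
  qed
  moreover have "s \<in> spline_space n v \<zeta> \<phi>"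
    using pc by (auto simp: spline_space_iff_pieces s_def)
  ultimately show ?thesis by blast
qed

section \<open>The B-spline-like functions and reproduction of polynomials\<close>

lemma bspline_interpolates:
  assumes "i \<le> n"
  shows "bspline n v \<zeta> \<phi> i \<alpha> \<in> spline_space n v \<zeta> \<phi>"
    and "interpolates (\<lambda>k j. if k = i then gam v \<zeta> \<phi> i \<alpha> j else 0) (bspline n v \<zeta> \<phi> i \<alpha>)"
proof -
  let ?d = "\<lambda>k j. if k = i then gam v \<zeta> \<phi> i \<alpha> j else 0"
  have eq: "((\<forall>j\<le>\<phi> i - 1. nth_deriv_within {v 0..v n} j s (v i) = gam v \<zeta> \<phi> i \<alpha> j) \<and>
     (\<forall>k\<le>n. k \<noteq> i \<longrightarrow> (\<forall>j\<le>\<phi> k - 1. nth_deriv_within {v 0..v n} j s (v k) = 0)))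
     \<longleftrightarrow> interpolates ?d s" for s
    using assms by (auto simp: interpolates_def)
  \<comment> \<open>Unique solvability makes the \<open>THE\<close> in \<open>bspline\<close> denote
    an actual spline.\<close>
  have "\<exists>!s. s \<in> spline_space n v \<zeta> \<phi> \<and> interpolates ?d s"
    using interpolates_exists[of ?d] interpolates_unique by blast
  from theI'[OF this] show "bspline n v \<zeta> \<phi> i \<alpha> \<in> spline_space n v \<zeta> \<phi>"
    "interpolates ?d (bspline n v \<zeta> \<phi> i \<alpha>)"
    unfolding bspline_def eq by auto
qed

text \<open>On each cell the superposed pieces and the pair consisting of \<open>p\<close> twice
  solve the same Hermite problem; the degree bound makes the latter admissible. Uniqueness on the
  cell then gives equality.\<close>

lemma quasi_interpolant_reproduces:
  assumes deg: "\<And>i. i \<le> n \<Longrightarrow> degree p \<le> \<phi> i" and x: "x \<in> {v 0..v n}"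
  shows "quasi_interpolant n v \<zeta> \<phi> (poly p) x = poly p x"
proof -
  define I where "I = Sigma {0..n} (\<lambda>i. multi_indices (\<phi> i - 1))"
  have fin: "finite I" by (simp add: I_def)
  define N where "N = (\<lambda>(i, \<alpha>). bspline n v \<zeta> \<phi> i \<alpha>)"
  define c where "c = (\<lambda>(i, \<alpha>). nu v \<zeta> i \<alpha> (poly p))"
  define d where "d = (\<lambda>(i, \<alpha>) k j. if k = i then gam v \<zeta> \<phi> i \<alpha> j else 0)"
  have "\<exists>L R. \<beta> \<in> I \<longrightarrow> pieces (N \<beta>) L R" for \<beta>
    using bspline_interpolates(1)[of "fst \<beta>" "snd \<beta>"]
    by (auto simp: I_def N_def spline_space_iff_pieces split: prod.splits)
  then obtain L R where pc: "\<And>\<beta>. \<beta> \<in> I \<Longrightarrow> pieces (N \<beta>) (L \<beta>) (R \<beta>)"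
    by metis
  have int: "interpolates (d \<beta>) (N \<beta>)" if "\<beta> \<in> I" for \<beta>
    using that bspline_interpolates(2) by (auto simp: I_def N_def d_def)
  \<comment> \<open>The data of the combination at vertex \<open>k\<close>: only the functions
    centred at \<open>k\<close> contribute, and \<open>sum_nu_gam\<close> evaluates their
    sum.\<close>
  have sum_d: "(\<Sum>\<beta>\<in>I. c \<beta> * d \<beta> k j) = poly ((pderiv ^^ j) p) (v k)" if k: "k \<le> n" and j: "j < \<phi> k" for k j
  proof -
    \<comment> \<open>The Bernstein interval stays nondegenerate at the first and last vertices,
      where one split point coincides with the vertex.\<close>
    have zeta_neq: "\<zeta> (int k - 1) \<noteq> \<zeta> (int k)"
    proof (cases k)
      case 0
      then show ?thesis using zeta_gt[of 0] n_ge_1 zeta_first by simp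
    next
      case (Suc k')
      have "v k \<le> \<zeta> (int k)"
        using k zeta_gt[of k] zeta_last by (cases "k = n") auto
      then show ?thesis using Suc k zeta_lt[of k'] by simp
    qed
    have "(\<Sum>\<beta>\<in>I. c \<beta> * d \<beta> k j)
      = (\<Sum>(i, \<alpha>)\<in>I. nu v \<zeta> i \<alpha> (poly p) * (if k = i then gam v \<zeta> \<phi> i \<alpha> j else 0))"
      by (simp add: c_def d_def split_def)
    also have "\<dots> = (\<Sum>i=0..n. \<Sum>\<alpha>\<in>multi_indices (\<phi> i - 1).
        nu v \<zeta> i \<alpha> (poly p) * (if k = i then gam v \<zeta> \<phi> i \<alpha> j else 0))"
      unfolding I_def by (rule sum.Sigma[symmetric]) auto
    also have "\<dots> = (\<Sum>i=0..n. if i = k then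
        (\<Sum>\<alpha>\<in>multi_indices (\<phi> k - 1). nu v \<zeta> k \<alpha> (poly p) * gam v \<zeta> \<phi> k \<alpha> j) else 0)"
      by (intro sum.cong) auto
    also have "\<dots> = (\<Sum>\<alpha>\<in>multi_indices (\<phi> k - 1). nu v \<zeta> k \<alpha> (poly p) * gam v \<zeta> \<phi> k \<alpha> j)"
      using k by simp
    also have "\<dots> = poly ((pderiv ^^ j) p) (v k)"
      using sum_nu_gam[where \<phi> = \<phi> and i = k and \<zeta> = \<zeta> and p = p] phi_ge_2[OF k] zeta_neq deg[OF k] j by simp
    finally show ?thesis .
  qed
  from x obtain i where i: "i < n" "x \<in> {v i..\<zeta> (int i)} \<or> x \<in> {\<zeta> (int i)..v (Suc i)}"
    by (rule between_breakpoints)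
  have "hermite_at (\<lambda>k j. \<Sum>\<beta>\<in>I. c \<beta> * d \<beta> k j) i
      (\<Sum>\<beta>\<in>I. smult (c \<beta>) (R \<beta> i)) (\<Sum>\<beta>\<in>I. smult (c \<beta>) (L \<beta> (Suc i)))"
    by (rule hermite_pair_sum[OF fin]) (use interpolates_pieces pc int i(1) in blast)
  moreover have "hermite_at (\<lambda>k j. \<Sum>\<beta>\<in>I. c \<beta> * d \<beta> k j) i p p"
    using sum_d i(1) deg by (simp add: hermite_pair_def smooth_join_def)
  ultimately have eq: "(\<Sum>\<beta>\<in>I. smult (c \<beta>) (R \<beta> i)) = p" "(\<Sum>\<beta>\<in>I. smult (c \<beta>) (L \<beta> (Suc i))) = p"
    using hermite_at_unique[OF i(1), where d = "\<lambda>k j. \<Sum>\<beta>\<in>I. c \<beta> * d \<beta> k j"] by auto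
  have "quasi_interpolant n v \<zeta> \<phi> (poly p) x = (\<Sum>\<beta>\<in>I. c \<beta> * N \<beta> x)"
    unfolding quasi_interpolant_def I_def by (subst sum.Sigma) (auto simp: c_def N_def split_def)
  also have "\<dots> = poly p x"
    using i(2)
  proof
    assume xi: "x \<in> {v i..\<zeta> (int i)}"
    have "(\<Sum>\<beta>\<in>I. c \<beta> * N \<beta> x) = poly (\<Sum>\<beta>\<in>I. smult (c \<beta>) (R \<beta> i)) x"
      unfolding poly_sum using pc xi i(1) by (intro sum.cong) (auto simp: pieces_def)
    then show ?thesis by (simp only: eq)
  next
    assume xi: "x \<in> {\<zeta> (int i)..v (Suc i)}"
    have "(\<Sum>\<beta>\<in>I. c \<beta> * N \<beta> x) = poly (\<Sum>\<beta>\<in>I. smult (c \<beta>) (L \<beta> (Suc i))) x"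
      unfolding poly_sum using pc xi i(1) by (intro sum.cong) (auto simp: pieces_def)
    then show ?thesis by (simp only: eq)
  qed
  finally show ?thesis .
qed

end

theorem corollary2:
  fixes n :: nat and a b :: real and v :: "nat \<Rightarrow> real" and \<zeta> :: "int \<Rightarrow> real"
    and \<phi> :: "nat \<Rightarrow> nat" and p :: "real poly"
  assumes "n \<ge> 1"
    and "v 0 = a" and "v n = b"
    and "\<And>i. i < n \<Longrightarrow> v i < v (Suc i)"
    and "\<And>i. i < n \<Longrightarrow> \<zeta> (int i) \<in> {v i<..<v (Suc i)}"
    and "\<zeta> (- 1) = v 0" and "\<zeta> (int n) = v n"
    and "\<And>i. i \<le> n \<Longrightarrow> \<phi> i \<ge> 2"
    and "degree p \<le> Min (\<phi> ` {0..n})"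
  shows "\<forall>x\<in>{a..b}. quasi_interpolant n v \<zeta> \<phi> (poly p) x = poly p x"
proof -
  interpret split_partition n v \<zeta> \<phi>
    using assms by unfold_locales
  have "degree p \<le> \<phi> i" if "i \<le> n" for i
    using assms(9) Min_le[of "\<phi> ` {0..n}" "\<phi> i"] that by fastforce
  then show ?thesis
    using quasi_interpolant_reproduces[of p] assms(2,3) by blast
qed

end
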